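(* For each integer $d\ge1$ and each $k=1,\dots,d$ there exists a constant $C(k,d)>0$ such that for all $\alpha\in[0,1)$, $$q_L(\alpha,d,k)\ \ge\ C(k,d)\,(1-\alpha)^k .$$
   Context: Setting: site percolation on $\mathbb Z^{d+1}$. $\Omega=\{0,1\}^{\mathbb Z^{d+1}}$, and for $p\in[0,1]$, $\mathbb P_p$ is the product measure on $\Omega$ of Bernoulli distributions with parameter $p$. A site $x$ is open if $\omega(x)=1$ and closed if $\omega(x)=0$. A function $F:\mathbb Z^d\to\mathbb Z$ is Lipschitz if $|F(\bar x)-F(\bar y)|\le 1$ whenever $\Vert\bar x-\bar y\Vert_1=1$. For $\alpha\in[0,1)$ and $\eta\in\{-1,0,+1\}^d$, $\mathsf{LIP}^{\alpha,d}_\eta$ is the event of all $\omega\in\Omega$ for which there is a Lipschitz function $F$ such that for all $\bar x\in\mathbb Z^d$: $\omega((\bar x,F(\bar x)))=1$ and $F(\bar x)>\lfloor\alpha\sum_{i=1}^d\eta_i\bar x_i\rfloor$. Critical probability: there is a number $p_L(\alpha,d,\eta)\in(0,1)$ such that $\mathbb P_p(\mathsf{LIP}^{\alpha,d}_\eta)=0$ for $p<p_L(\alpha,d,\eta)$ and $=1$ for $p>p_L(\alpha,d,\eta)$; it depends on $\eta$ only through $k=\Vert\eta\Vert_1\in\{0,\dots,d\}$ and is written $p_L(\alpha,d,k)$. Put $q_L(\alpha,d,k):=1-p_L(\alpha,d,k)$. *)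

theory Defs
  imports "HOL-Probability.Probability"
begin

text \<open>The lattice dimension \<open>d\<close> is \<open>CARD('d)\<close>. A site of the lattice of dimension \<open>d + 1\<close> is split
  into its first \<open>d\<close> coordinates and its last one. In a configuration, \<^const>\<open>True\<close> stands for the
  value 1 (open).\<close>

type_synonym 'd site = "(int ^ 'd) \<times> int"
type_synonym 'd config = "'d site \<Rightarrow> bool"

definition site_perc :: "real \<Rightarrow> ('d::finite) config measure" where
  "site_perc p = (\<Pi>\<^sub>M x\<in>UNIV. measure_pmf (bernoulli_pmf p))"

definition l1norm :: "int ^ 'd::finite \<Rightarrow> int" where
  "l1norm x = (\<Sum>i\<in>UNIV. \<bar>x $ i\<bar>)"

definition lipschitz_fun :: "(int ^ 'd::finite \<Rightarrow> int) \<Rightarrow> bool" where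
  "lipschitz_fun F \<longleftrightarrow> (\<forall>x y. l1norm (x - y) = 1 \<longrightarrow> \<bar>F x - F y\<bar> \<le> 1)"

definition sign_vectors :: "(int ^ 'd::finite) set" where
  "sign_vectors = {\<eta>. \<forall>i. \<eta> $ i \<in> {-1, 0, 1}}"

definition LIP :: "real \<Rightarrow> int ^ 'd::finite \<Rightarrow> 'd config set" where
  "LIP \<alpha> \<eta> = {\<omega>. \<exists>F. lipschitz_fun F \<and>
     (\<forall>x. \<omega> (x, F x) \<and> F x > \<lfloor>\<alpha> * of_int (\<Sum>i\<in>UNIV. \<eta> $ i * x $ i)\<rfloor>)}"

definition p_L :: "real \<Rightarrow> int ^ 'd::finite \<Rightarrow> real" where
  "p_L \<alpha> \<eta> = (THE c. 0 < c \<and> c < 1 \<and>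
     (\<forall>p\<in>{0..1}. (p < c \<longrightarrow> measure (site_perc p) (LIP \<alpha> \<eta>) = 0) \<and>
                 (p > c \<longrightarrow> measure (site_perc p) (LIP \<alpha> \<eta>) = 1)))"

definition q_L :: "real \<Rightarrow> int ^ 'd::finite \<Rightarrow> real" where
  "q_L \<alpha> \<eta> = 1 - p_L \<alpha> \<eta>"

end

theory Submission
  imports Defs
begin

text \<open>Fix an obstacle function \<open>g\<close> on the base lattice; for the event \<^const>\<open>LIP\<close> it is the rounded tilted
plane. Start from a point of the graph of \<open>g\<close> and repeatedly jump: from a point \<open>(x, h)\<close> move to
\<open>(x + v, h + 1 - \<bar>v\<bar>)\<close>, with \<open>\<bar>v\<bar>\<close> the l1 norm, provided that this site is closed. Every open
Lipschitz surface above \<open>g\<close> has to stay above all points reached in this way, and if these points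
do not climb arbitrarily high, then one plus the supremum of the downward l1 cones below them is
such a surface. So a surface exists as soon as the heights above the origin of the cones of all
reached points are bounded (\<open>Lip_above_iff\<close>).

Boundedness is a first moment computation. A chain of jumps may be taken without repeated sites
(\<open>climbs_inj\<close>), so a given chain with \<open>n\<close> jumps is closed with probability \<open>q\<^sup>n\<close>, where
\<open>q = 1 - p\<close>. A chain is determined by its displacements \<open>v\<^sub>0, \<dots>, v\<^sub>n\<close>, the last one leading back
above the origin. If it reaches height \<open>m\<close> there, then \<open>n\<close> is at least \<open>m\<close> plus the sum of the
costs \<open>\<bar>v\<bar> + \<alpha> (\<eta> \<bullet> v)\<close> of its displacements: each unit of displacement loses one unit of height,
up to the height that is gained from the tilt of the starting plane. Bounding the indicator of
this inequality by two to the power of the difference of its sides gives the estimate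
\<open>2\<^sup>-\<^sup>m K (\<Sum>n. (2 q K)\<^sup>n)\<close>, where \<open>K\<close> is the sum of \<open>2\<close> to the power of minus the cost over all
displacements. This sum is a product over the coordinates. A coordinate in which the plane is
horizontal contributes at most 3; a tilted one contributes at most \<open>3 / (1 - \<alpha>)\<close>, since a unit
step down the slope costs only \<open>1 - \<alpha>\<close>. Hence \<open>K\<close> is at most \<open>3\<^sup>d / (1 - \<alpha>)\<^sup>k\<close>, and the series
converges for \<open>q < (1 - \<alpha>)\<^sup>k / (2 \<cdot> 3\<^sup>d)\<close>. That the order of the unit steps between two
consecutive closed sites is not counted is what makes the bound polynomial in \<open>1 - \<alpha>\<close>.

The critical value is a definite description, so its existence and uniqueness are part of the
proof. They follow from a zero-one law (\<open>Lip_above_zero_one\<close>), from monotonicity in \<open>p\<close>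
(\<open>site_perc_mono\<close>) and from the absence of surfaces for \<open>p < 1/3\<close> (\<open>Lip_above_null\<close>).\<close>

section \<open>Monotone coupling and zero-one law for product measures\<close>

lemma space_site_perc [simp]: "space (site_perc p) = UNIV"
  by (simp add: site_perc_def space_PiM)

lemma sets_site_perc: "sets (site_perc p) = sets (site_perc p')"
  unfolding site_perc_def by (intro sets_PiM_cong) simp_all

lemma prob_space_site_perc: "prob_space (site_perc p)"
  unfolding site_perc_def by (intro prob_space_PiM measure_pmf.prob_space_axioms)

lemma measurable_site [measurable]: "(\<lambda>\<omega>. \<omega> x) \<in> measurable (site_perc p) (count_space UNIV)"
  unfolding site_perc_def by simp

lemma product_prob_space_pmf: "product_prob_space (\<lambda>x. measure_pmf (f x))"
  by (intro product_prob_spaceI measure_pmf.prob_space_axioms)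

lemma prob_all_sites:
  assumes J: "finite J"
  shows "measure (site_perc p) {\<omega>. \<forall>x\<in>J. \<omega> x = b} = pmf (bernoulli_pmf p) b ^ card J"
proof -
  interpret product_prob_space "\<lambda>_. measure_pmf (bernoulli_pmf p)" UNIV
    by (rule product_prob_space_pmf)
  have "emeasure (site_perc p) {\<omega>. \<forall>x\<in>J. \<omega> x = b} = (\<Prod>x\<in>J. emeasure (measure_pmf (bernoulli_pmf p)) {b})"
    using emeasure_PiM_Collect[of J "\<lambda>_. {b}"] J by (simp add: site_perc_def space_PiM)
  also have "\<dots> = ennreal (pmf (bernoulli_pmf p) b ^ card J)"
    by (simp add: emeasure_pmf_single ennreal_power)
  finally show ?thesis by (simp add: measure_def)
qed

lemma distr_PiM_map_pmf:
  "distr (\<Pi>\<^sub>M x\<in>UNIV. measure_pmf \<pi>) (\<Pi>\<^sub>M x\<in>UNIV. measure_pmf (map_pmf f \<pi>)) (\<lambda>\<omega> x. f (\<omega> x))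
    = (\<Pi>\<^sub>M x\<in>(UNIV :: 'i set). measure_pmf (map_pmf f \<pi>))"
proof -
  interpret P: product_prob_space "\<lambda>_::'i. measure_pmf \<pi>" UNIV
    by (rule product_prob_space_pmf)
  interpret Q: product_prob_space "\<lambda>_::'i. measure_pmf (map_pmf f \<pi>)" UNIV
    by (rule product_prob_space_pmf)
  have meas: "(\<lambda>\<omega> x. f (\<omega> x)) \<in> measurable (\<Pi>\<^sub>M x\<in>(UNIV :: 'i set). measure_pmf \<pi>) (\<Pi>\<^sub>M x\<in>UNIV. measure_pmf (map_pmf f \<pi>))"
    by (rule measurable_PiM_single')
      (auto simp: space_PiM intro: measurable_compose[OF measurable_component_singleton])
  show ?thesis
  proof (rule Q.PiM_eq)
    fix J :: "'i set" and F
    assume J: "finite J"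
    have eq: "(\<lambda>\<omega> x. f (\<omega> x)) -` prod_emb UNIV (\<lambda>_. measure_pmf (map_pmf f \<pi>)) J (Pi\<^sub>E J F)
        \<inter> space (\<Pi>\<^sub>M x\<in>UNIV. measure_pmf \<pi>)
      = {\<omega> \<in> space (\<Pi>\<^sub>M x\<in>UNIV. measure_pmf \<pi>). \<forall>j\<in>J. \<omega> j \<in> f -` F j}"
      by (auto simp: prod_emb_def space_PiM PiE_iff)
    show "emeasure (distr (\<Pi>\<^sub>M x\<in>UNIV. measure_pmf \<pi>) (\<Pi>\<^sub>M x\<in>UNIV. measure_pmf (map_pmf f \<pi>)) (\<lambda>\<omega> x. f (\<omega> x)))
        (prod_emb UNIV (\<lambda>_. measure_pmf (map_pmf f \<pi>)) J (Pi\<^sub>E J F)) =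
       (\<Prod>j\<in>J. emeasure (measure_pmf (map_pmf f \<pi>)) (F j))"
      apply (subst emeasure_distr[OF meas])
      subgoal using J by (auto intro!: sets_PiM_I)
      subgoal unfolding eq by (subst P.emeasure_PiM_Collect) (use J in auto)
      done
  qed simp
qed

text \<open>A Bernoulli variable becomes one with a larger parameter by taking the disjunction with an
independent Bernoulli variable. The first component and the disjunction are then a monotone coupling.\<close>

lemma bernoulli_or:
  assumes "0 \<le> p" "p \<le> p'" "p' \<le> 1"
  shows "\<exists>\<pi> :: (bool \<times> bool) pmf. map_pmf fst \<pi> = bernoulli_pmf p \<and>
           map_pmf (\<lambda>z. fst z \<or> snd z) \<pi> = bernoulli_pmf p'"
proof -
  define r where "r = (if p = 1 then 0 else (p' - p) / (1 - p))"
  have r: "0 \<le> r \<and> r \<le> 1 \<and> (1 - p) * (1 - r) = 1 - p'"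
  proof (cases "p = 1")
    case False
    with assms have "0 < 1 - p" by simp
    moreover from this have "(1 - p) * r = p' - p" using False by (simp add: r_def)
    ultimately show ?thesis using assms False by (simp add: right_diff_distrib r_def)
  qed (use assms in \<open>simp add: r_def\<close>)
  let ?\<pi> = "pair_pmf (bernoulli_pmf p) (bernoulli_pmf r)"
  let ?m = "map_pmf (\<lambda>z. fst z \<or> snd z) ?\<pi>"
  have F: "pmf ?m False = 1 - p'"
  proof -
    have *: "(\<lambda>z. fst z \<or> snd z) -` {False} = {(False, False)}"
      by (rule set_eqI, case_tac x, simp)
    have "pmf ?m False = pmf ?\<pi> (False, False)"
      unfolding pmf_map * by (rule measure_pmf_single)
    also have "\<dots> = (1 - p) * (1 - r)"
      using assms r by (subst pmf_pair) (simp only: pmf_bernoulli_False)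
    finally show ?thesis using r by simp
  qed
  have tot: "pmf \<mu> True + pmf \<mu> False = 1" for \<mu> :: "bool pmf"
  proof -
    have "set_pmf \<mu> \<subseteq> {True, False}" by auto
    then have "(\<Sum>b\<in>{True, False}. pmf \<mu> b) = 1" by (intro sum_pmf_eq_1) auto
    then show ?thesis by simp
  qed
  have "?m = bernoulli_pmf p'"
  proof (rule pmf_eqI)
    fix b show "pmf ?m b = pmf (bernoulli_pmf p') b"
      using F tot[of ?m] assms by (cases b) (simp_all only: pmf_bernoulli_True pmf_bernoulli_False)
  qed
  then show ?thesis by (intro exI[of _ ?\<pi>]) (simp add: map_fst_pair_pmf)
qed

text \<open>The one-site coupling is applied independently at every site, so that every site that is open at
\<open>p\<close> is open at \<open>p'\<close>.\<close>

lemma site_perc_mono: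
  fixes A :: "'d::finite config set"
  assumes p: "0 \<le> p" "p \<le> p'" "p' \<le> 1"
    and A: "A \<in> sets (site_perc p)"
    and incr: "\<And>\<omega> \<omega>'. \<omega> \<in> A \<Longrightarrow> (\<And>x. \<omega> x \<Longrightarrow> \<omega>' x) \<Longrightarrow> \<omega>' \<in> A"
  shows "measure (site_perc p) A \<le> measure (site_perc p') A"
proof -
  obtain \<pi> :: "(bool \<times> bool) pmf" where \<pi>: "bernoulli_pmf p = map_pmf fst \<pi>"
      "bernoulli_pmf p' = map_pmf (\<lambda>z. fst z \<or> snd z) \<pi>"
    using bernoulli_or[OF p] by metis
  let ?P = "\<Pi>\<^sub>M x\<in>(UNIV :: 'd site set). measure_pmf \<pi>"
  interpret P: prob_space ?P
    by (intro prob_space_PiM measure_pmf.prob_space_axioms)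
  have A': "A \<in> sets (site_perc p')" using A sets_site_perc by blast
  have meas: "(\<lambda>\<omega> x. f (\<omega> x)) \<in> measurable ?P (site_perc r)" for f r
    unfolding site_perc_def by (rule measurable_PiM_single')
      (auto simp: space_PiM intro: measurable_compose[OF measurable_component_singleton])
  have 1: "site_perc p = distr ?P (site_perc p) (\<lambda>\<omega> x. fst (\<omega> x))"
    unfolding site_perc_def \<pi> by (rule distr_PiM_map_pmf[symmetric])
  have 2: "site_perc p' = distr ?P (site_perc p') (\<lambda>\<omega> x. fst (\<omega> x) \<or> snd (\<omega> x))"
    unfolding site_perc_def \<pi> by (rule distr_PiM_map_pmf[symmetric])
  have "measure (site_perc p) A = measure ?P ((\<lambda>\<omega> x. fst (\<omega> x)) -` A \<inter> space ?P)"
    by (subst 1) (simp add: measure_distr meas A)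
  also have "\<dots> \<le> measure ?P ((\<lambda>\<omega> x. fst (\<omega> x) \<or> snd (\<omega> x)) -` A \<inter> space ?P)"
    using measurable_sets[OF meas A', of "\<lambda>z. fst z \<or> snd z"]
    by (intro P.finite_measure_mono) (auto intro: incr)
  also have "\<dots> = measure (site_perc p') A"
    by (subst 2) (simp add: measure_distr meas[of "\<lambda>z. fst z \<or> snd z"] A')
  finally show ?thesis .
qed

lemma indep_vars_PiM_coordinates:
  assumes "\<And>i. i \<in> I \<Longrightarrow> prob_space (M i)" "I \<noteq> {}"
  shows "prob_space.indep_vars (PiM I M) M (\<lambda>i \<omega>. \<omega> i) I"
proof -
  interpret prob_space "PiM I M" by (intro prob_space_PiM assms)
  have "distr (PiM I M) (PiM I M) (\<lambda>\<omega>. \<lambda>i\<in>I. \<omega> i) = distr (PiM I M) (PiM I M) (\<lambda>\<omega>. \<omega>)"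
    by (intro distr_cong) (auto simp: space_PiM PiE_def extensional_restrict)
  also have "\<dots> = PiM I M" by (simp add: distr_id)
  also have "\<dots> = (\<Pi>\<^sub>M i\<in>I. distr (PiM I M) (M i) (\<lambda>\<omega>. \<omega> i))"
    by (intro PiM_cong) (simp_all add: distr_PiM_component assms)
  finally show ?thesis
    by (subst indep_vars_iff_distr_eq_PiM') (auto simp: assms)
qed

text \<open>Replacing the first \<open>n\<close> coordinates by a constant leaves \<open>X\<close> unchanged, so \<open>X\<close> is measurable with
respect to the remaining coordinates, for every \<open>n\<close>. It is therefore a tail event of the independent
coordinate \<open>\<sigma>\<close>-algebras, and Kolmogorov's law applies.\<close>

lemma zero_one_finite_modification:
  fixes X :: "('i \<Rightarrow> 'b) set" and e :: "nat \<Rightarrow> 'i"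
  assumes e: "bij e"
    and M: "prob_space M"
    and sp: "space M = UNIV"
    and X: "X \<in> sets (PiM UNIV (\<lambda>_. M))"
    and fin: "\<And>\<omega> \<omega>'. \<omega> \<in> X \<Longrightarrow> finite {i. \<omega> i \<noteq> \<omega>' i} \<Longrightarrow> \<omega>' \<in> X"
  shows "measure (PiM UNIV (\<lambda>_. M)) X \<in> {0, 1}"
proof -
  let ?P = "PiM (UNIV :: 'i set) (\<lambda>_. M)"
  interpret prob_space ?P by (intro prob_space_PiM M)
  have spP: "space ?P = UNIV" by (simp add: space_PiM sp)
  define A where "A i = {(\<lambda>\<omega> :: 'i \<Rightarrow> 'b. \<omega> i) -` B \<inter> space ?P |B. B \<in> sets M}" for i
  have "indep_sets A UNIV"
    using indep_vars_PiM_coordinates[of "UNIV :: 'i set" "\<lambda>_. M"] M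
    unfolding indep_vars_def2 A_def by auto
  then have indep: "indep_sets (\<lambda>n. A (e n)) UNIV"
    unfolding indep_sets_def
  proof (intro conjI ballI allI impI, goal_cases)
    case (1 i) then show ?case by blast
  next
    case (2 J B)
    have ev: "prob (\<Inter>j\<in>K. C j) = (\<Prod>j\<in>K. prob (C j))"
      if "K \<noteq> {}" "finite K" "C \<in> Pi K A" for K C
      using 2(1)[THEN conjunct2, rule_format, OF subset_UNIV that] .
    have "B \<circ> inv e \<in> Pi (e ` J) A"
      using 2 e by (auto simp: bij_is_inj)
    moreover have "finite (e ` J)" "e ` J \<noteq> {}" using 2 by auto
    ultimately have "prob (\<Inter>j\<in>e ` J. (B \<circ> inv e) j) = (\<Prod>j\<in>e ` J. prob ((B \<circ> inv e) j))"
      by (intro ev) auto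
    moreover have "inj_on e J" using e by (meson bij_is_inj inj_on_subset subset_UNIV)
    ultimately show ?case
      using e by (simp add: prod.reindex bij_is_inj)
  qed
  have "X \<in> sigma_sets (space ?P) (\<Union>i\<in>{n..}. A (e i))" for n
  proof -
    let ?S = "sigma UNIV (\<Union>i\<in>{n..}. A (e i))"
    obtain b :: 'b where True by simp
    define f where "f \<omega> = (\<lambda>i. if i \<in> e ` {..<n} then b else \<omega> i)" for \<omega>
    have "f \<in> measurable ?S ?P"
    proof (rule measurable_PiM_single')
      fix i
      show "(\<lambda>\<omega>. f \<omega> i) \<in> measurable ?S M"
      proof (cases "i \<in> e ` {..<n}")
        case True
        then show ?thesis by (simp add: f_def sp)
      next
        case False
        obtain m where m: "i = e m" using e by (metis bij_is_surj surjD)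
        then have "m \<ge> n" using False by (auto simp: not_less[symmetric])
        then have "A i \<subseteq> sets ?S" using m by (auto intro!: sigma_sets.Basic)
        then have "(\<lambda>\<omega>. \<omega> i) \<in> measurable ?S M"
          by (intro measurableI) (auto simp: sp A_def spP)
        then show ?thesis using False by (simp add: f_def)
      qed
    qed (simp add: sp)
    then have "f -` X \<inter> space ?S \<in> sets ?S" using X by (rule measurable_sets)
    moreover have "f -` X = X"
    proof -
      have "finite {i. \<omega> i \<noteq> f \<omega> i}" "finite {i. f \<omega> i \<noteq> \<omega> i}" for \<omega>
        by (auto simp: f_def intro: finite_subset[of _ "e ` {..<n}"])
      then show ?thesis using fin by (auto simp: vimage_def)
    qed
    ultimately show ?thesis by (simp add: spP)
  qed
  then have tail: "X \<in> tail_events (\<lambda>n. A (e n))"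
    by (auto simp: tail_events_def)
  have "sigma_algebra (space ?P) (A i)" for i
  proof -
    have "A i = sets (vimage_algebra UNIV (\<lambda>\<omega>. \<omega> i) M)"
      by (subst sets_vimage_algebra2) (auto simp: A_def spP sp)
    then show ?thesis
      using sets.sigma_algebra_axioms[of "vimage_algebra UNIV (\<lambda>\<omega> :: 'i \<Rightarrow> 'b. \<omega> i) M"]
      by (simp add: spP)
  qed
  from kolmogorov_0_1_law[OF this indep tail] show ?thesis by auto
qed

section \<open>Surfaces and chains of jumps\<close>

lemma l1norm_nonneg: "0 \<le> l1norm x"
  by (simp add: l1norm_def sum_nonneg)

lemma l1norm_0 [simp]: "l1norm 0 = 0"
  by (simp add: l1norm_def)

lemma l1norm_minus_commute: "l1norm (x - y) = l1norm (y - x)"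
  by (simp add: l1norm_def abs_minus_commute)

lemma l1norm_minus [simp]: "l1norm (- x) = l1norm x"
  by (simp add: l1norm_def)

lemma l1norm_triangle: "l1norm (x - z) \<le> l1norm (x - y) + l1norm (y - z)"
  unfolding l1norm_def sum.distrib[symmetric] by (intro sum_mono) auto

text \<open>The defining condition only speaks of neighbours; walk from \<open>x\<close> to \<open>y\<close> along a shortest lattice path.\<close>

lemma lipschitz_fun_l1:
  assumes F: "lipschitz_fun F"
  shows "\<bar>F x - F y\<bar> \<le> l1norm (x - y)"
proof (induction "nat (l1norm (x - y))" arbitrary: x)
  case 0
  then have "l1norm (x - y) = 0" using l1norm_nonneg[of "x - y"] by simp
  then have "x = y" by (simp add: l1norm_def sum_nonneg_eq_0_iff vec_eq_iff)
  then show ?case by simp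
next
  case (Suc n)
  then have "x \<noteq> y" by auto
  then obtain i where i: "x $ i \<noteq> y $ i" by (auto simp: vec_eq_iff)
  define x' where "x' = x - axis i (sgn (x $ i - y $ i))"
  have x': "x' $ j = (if j = i then x $ i - sgn (x $ i - y $ i) else x $ j)" for j
    by (simp add: x'_def axis_def)
  have "l1norm (x - x') = (\<Sum>j\<in>UNIV. if j = i then 1 else 0)"
    unfolding l1norm_def using i by (intro sum.cong) (auto simp: x' sgn_if)
  then have step: "l1norm (x - x') = 1" by simp
  have "l1norm (x' - y) = (\<Sum>j\<in>UNIV. \<bar>(x - y) $ j\<bar> - (if j = i then 1 else 0))"
    unfolding l1norm_def using i by (intro sum.cong) (auto simp: x' sgn_if)
  then have closer: "l1norm (x' - y) = l1norm (x - y) - 1"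
    by (simp add: sum_subtractf l1norm_def)
  have "\<bar>F x' - F y\<bar> \<le> l1norm (x' - y)"
    using Suc closer by (intro Suc.hyps) simp
  moreover have "\<bar>F x - F x'\<bar> \<le> 1"
    using F step by (auto simp: lipschitz_fun_def)
  ultimately show ?case using closer by linarith
qed

definition Lip_above :: "(int ^ 'd::finite \<Rightarrow> int) \<Rightarrow> 'd config set" where
  "Lip_above g = {\<omega>. \<exists>F. lipschitz_fun F \<and> (\<forall>x. \<omega> (x, F x) \<and> F x > g x)}"

text \<open>A jump by \<open>v\<close> packs \<open>\<bar>v\<bar>\<close> free diagonal steps down, in any order, and one step up.\<close>

definition jump_chain :: "(int ^ 'd::finite \<Rightarrow> int) \<Rightarrow> nat \<Rightarrow> (nat \<Rightarrow> 'd site) \<Rightarrow> bool" where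
  "jump_chain g n s \<longleftrightarrow> snd (s 0) = g (fst (s 0)) \<and>
     (\<forall>i<n. snd (s (Suc i)) = snd (s i) + 1 - l1norm (fst (s (Suc i)) - fst (s i)))"

text \<open>The height above the origin of the downward l1 cone with apex \<open>z\<close>, that is, the least height at the
origin of a function that is Lipschitz and passes through \<open>z\<close>.\<close>

definition cone_height :: "'d::finite site \<Rightarrow> int" where
  "cone_height z = snd z - l1norm (fst z)"

definition closed_chain :: "(int ^ 'd::finite \<Rightarrow> int) \<Rightarrow> 'd config \<Rightarrow> nat \<Rightarrow> (nat \<Rightarrow> 'd site) \<Rightarrow> bool" where
  "closed_chain g \<omega> n s \<longleftrightarrow> jump_chain g n s \<and> (\<forall>i\<in>{1..n}. \<not> \<omega> (s i))"

definition climbs :: "(int ^ 'd::finite \<Rightarrow> int) \<Rightarrow> int \<Rightarrow> nat \<Rightarrow> 'd config set" where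
  "climbs g m n = {\<omega>. \<exists>s. closed_chain g \<omega> n s \<and> m \<le> cone_height (s n)}"

text \<open>A jump from strictly below the surface ends at most on the surface, by the Lipschitz property; it
cannot end on it, since the surface is open and the chain is closed.\<close>

lemma closed_chain_below:
  assumes F: "lipschitz_fun F" "\<And>x. \<omega> (x, F x)" "\<And>x. g x < F x"
    and s: "closed_chain g \<omega> n s"
  shows "i \<le> n \<Longrightarrow> snd (s i) < F (fst (s i))"
proof (induction i)
  case 0
  then show ?case using s F by (simp add: closed_chain_def jump_chain_def)
next
  case (Suc i)
  let ?x = "fst (s i)" and ?y = "fst (s (Suc i))"
  have "\<bar>F ?x - F ?y\<bar> \<le> l1norm (?y - ?x)"
    using lipschitz_fun_l1[OF F(1)] by (metis l1norm_minus_commute)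
  moreover have "snd (s (Suc i)) = snd (s i) + 1 - l1norm (?y - ?x)"
    using s Suc by (auto simp: closed_chain_def jump_chain_def)
  ultimately have "snd (s (Suc i)) \<le> F ?y" using Suc by simp
  moreover have "\<not> \<omega> (s (Suc i))" using s Suc by (simp add: closed_chain_def)
  then have "snd (s (Suc i)) \<noteq> F ?y" using F(2)[of ?y] by (metis prod.collapse)
  ultimately show ?case by simp
qed

lemma closed_chain_extend:
  assumes s: "closed_chain g \<omega> n s" and z: "\<not> \<omega> z"
    and h: "snd z = snd (s n) + 1 - l1norm (fst z - fst (s n))"
  shows "closed_chain g \<omega> (Suc n) (s(Suc n := z))"
  using assms by (auto simp: closed_chain_def jump_chain_def less_Suc_eq le_Suc_eq)

lemma bdd_above_int_Sup_in:
  fixes X :: "int set"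
  assumes "X \<noteq> {}" "bdd_above X"
  shows "Sup X \<in> X"
proof -
  obtain B where "X \<subseteq> {..B}" using assms by (auto simp: bdd_above_def)
  obtain x where x: "x \<in> X" using assms by auto
  have "finite (X \<inter> {x..})" by (rule finite_subset[of _ "{x..B}"]) (use \<open>X \<subseteq> {..B}\<close> in auto)
  then have M: "Max (X \<inter> {x..}) \<in> X \<inter> {x..}" by (rule Max_in) (use x in auto)
  have "Sup X = Max (X \<inter> {x..})"
  proof (rule cSup_eq_maximum)
    show "Max (X \<inter> {x..}) \<in> X" using M by simp
    fix y assume "y \<in> X"
    show "y \<le> Max (X \<inter> {x..})"
    proof (cases "y \<ge> x")
      case True
      then show ?thesis using \<open>y \<in> X\<close> \<open>finite _\<close> by (intro Max_ge) auto
    next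
      case False
      then show ?thesis using M by auto
    qed
  qed
  then show ?thesis using M by auto
qed

text \<open>The surface built from the chains is the upper envelope of the downward cones of all reached sites,
raised by one. It is open: at a closed site of it, one could extend the chain attaining the supremum
by a jump onto that site, and the surface would lie above itself.\<close>

lemma Lip_above_iff:
  "\<omega> \<in> Lip_above g \<longleftrightarrow> (\<exists>m. \<forall>n. \<omega> \<notin> climbs g m n)"
proof
  assume "\<omega> \<in> Lip_above g"
  then obtain F where F: "lipschitz_fun F" "\<And>x. \<omega> (x, F x)" "\<And>x. g x < F x"
    by (auto simp: Lip_above_def)
  have "cone_height (s n) < F 0" if "closed_chain g \<omega> n s" for n s
  proof -
    have "snd (s n) < F (fst (s n))"
      using closed_chain_below[of F \<omega> g n s n] F that by auto
    then show ?thesis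
      using lipschitz_fun_l1[OF F(1), of "fst (s n)" 0] by (simp add: cone_height_def)
  qed
  then show "\<exists>m. \<forall>n. \<omega> \<notin> climbs g m n"
    by (intro exI[of _ "F 0"]) (auto simp: climbs_def not_le)
next
  assume "\<exists>m. \<forall>n. \<omega> \<notin> climbs g m n"
  then obtain m where m: "cone_height (s n) < m" if "closed_chain g \<omega> n s" for n s
    by (auto simp: climbs_def not_le)
  define S where "S = {s n |s n. closed_chain g \<omega> n s}"
  define V where "V x = (\<lambda>z. snd z - l1norm (x - fst z)) ` S" for x
  define F where "F x = Sup (V x) + 1" for x
  have base: "(x, g x) \<in> S" for x
  proof -
    have "closed_chain g \<omega> 0 (\<lambda>_. (x, g x))" by (simp add: closed_chain_def jump_chain_def)
    then show ?thesis unfolding S_def by (auto intro!: exI[of _ "\<lambda>_. (x, g x)"])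
  qed
  have bdd: "bdd_above (V x)" for x
  proof (rule bdd_aboveI)
    fix v assume "v \<in> V x"
    then obtain s n where s: "closed_chain g \<omega> n s" "v = snd (s n) - l1norm (x - fst (s n))"
      by (auto simp: V_def S_def)
    have "l1norm (fst (s n)) \<le> l1norm (x - fst (s n)) + l1norm x"
      using l1norm_triangle[of "fst (s n)" 0 x] by (simp add: l1norm_minus_commute)
    then show "v \<le> m + l1norm x" using m[OF s(1)] s(2) by (simp add: cone_height_def)
  qed
  have in_V: "Sup (V x) \<in> V x" for x
    using base bdd by (intro bdd_above_int_Sup_in) (auto simp: V_def)
  have F_ge: "snd z - l1norm (x - fst z) < F x" if "z \<in> S" for x z
    unfolding F_def using bdd[of x] that by (intro zle_add1_eq_le[THEN iffD2] cSup_upper) (auto simp: V_def)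
  have F_le: "F y \<le> F x + l1norm (x - y)" for x y
  proof -
    obtain z where z: "z \<in> S" "F y = snd z - l1norm (y - fst z) + 1"
      using in_V[of y] by (auto simp: V_def F_def)
    show ?thesis
      using F_ge[OF z(1), of x] z(2) l1norm_triangle[of x "fst z" y] by simp
  qed
  have "lipschitz_fun F"
    unfolding lipschitz_fun_def
  proof (intro allI impI)
    fix x y :: "int ^ 'a" assume "l1norm (x - y) = 1"
    then show "\<bar>F x - F y\<bar> \<le> 1"
      using F_le[of x y] F_le[of y x] by (simp add: l1norm_minus_commute[of y x])
  qed
  moreover have "g x < F x" for x using F_ge[OF base, of x x] by simp
  moreover have "\<omega> (x, F x)" for x
  proof (rule ccontr)
    assume closed: "\<not> \<omega> (x, F x)"
    obtain s n where s: "closed_chain g \<omega> n s" "F x = snd (s n) - l1norm (x - fst (s n)) + 1"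
      using in_V[of x] by (auto simp: V_def F_def S_def)
    have "closed_chain g \<omega> (Suc n) (s(Suc n := (x, F x)))"
      using s closed by (intro closed_chain_extend) auto
    then have "(x, F x) \<in> S" unfolding S_def
      by (auto intro!: exI[of _ "s(Suc n := (x, F x))"] exI[of _ "Suc n"])
    from F_ge[OF this, of x] show False by simp
  qed
  ultimately show "\<omega> \<in> Lip_above g" by (auto simp: Lip_above_def)
qed

section \<open>Measurability\<close>

text \<open>Chains are made extensional, so that there are only countably many of a given length. This yields
the measurability of \<^const>\<open>Lip_above\<close>, whose definition quantifies over uncountably many surfaces.\<close>

definition chain_shapes :: "(int ^ 'd::finite \<Rightarrow> int) \<Rightarrow> int \<Rightarrow> nat \<Rightarrow> (nat \<Rightarrow> 'd site) set" where
  "chain_shapes g m n = {s \<in> extensional {..n}. jump_chain g n s \<and> m \<le> cone_height (s n)}"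

lemma countable_chain_shapes: "countable (chain_shapes g m n :: (nat \<Rightarrow> 'd::finite site) set)"
proof (rule countable_subset)
  show "chain_shapes g m n \<subseteq> PiE {..n} (\<lambda>_. UNIV)"
    by (auto simp: chain_shapes_def PiE_def)
  show "countable (PiE {..n} (\<lambda>_. UNIV :: 'd site set))"
    by (intro countable_PiE) auto
qed

lemma closed_chain_cong:
  assumes "\<And>i. i \<le> n \<Longrightarrow> s i = t i"
  shows "closed_chain g \<omega> n s \<longleftrightarrow> closed_chain g \<omega> n t"
  using assms by (auto simp: closed_chain_def jump_chain_def)

lemma climbs_eq:
  "climbs g m n = (\<Union>s\<in>chain_shapes g m n. {\<omega>. \<forall>i\<in>{1..n}. \<not> \<omega> (s i)})"
proof (intro set_eqI iffI)
  fix \<omega> assume "\<omega> \<in> climbs g m n"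
  then obtain s where s: "closed_chain g \<omega> n s" "m \<le> cone_height (s n)"
    by (auto simp: climbs_def)
  have "closed_chain g \<omega> n (restrict s {..n})"
    using s(1) closed_chain_cong[of n s "restrict s {..n}" g \<omega>] by simp
  then show "\<omega> \<in> (\<Union>s\<in>chain_shapes g m n. {\<omega>. \<forall>i\<in>{1..n}. \<not> \<omega> (s i)})"
    using s(2) by (intro UN_I[of "restrict s {..n}"]) (auto simp: chain_shapes_def closed_chain_def)
qed (auto simp: climbs_def closed_chain_def chain_shapes_def)

lemma sets_all_sites:
  "finite J \<Longrightarrow> {\<omega>. \<forall>i\<in>J. \<omega> (f i) = b} \<in> sets (site_perc p)"
proof -
  assume "finite J"
  then have "{\<omega> \<in> space (site_perc p). \<forall>i\<in>J. \<omega> (f i) = b} \<in> sets (site_perc p)"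
    by measurable
  then show ?thesis by simp
qed

lemma sets_climbs: "climbs g m n \<in> sets (site_perc p)"
  unfolding climbs_eq using sets_all_sites[of "{1..n}" _ False]
  by (intro sets.countable_UN' countable_chain_shapes) auto

lemma Lip_above_eq: "Lip_above g = (\<Union>m. \<Inter>n. UNIV - climbs g m n)"
  by (simp add: set_eq_iff Lip_above_iff)

lemma sets_Lip_above: "Lip_above g \<in> sets (site_perc p)"
proof -
  have "UNIV - climbs g m n \<in> sets (site_perc p)" for m n
    using sets.compl_sets[OF sets_climbs[of g m n p]] by simp
  then show ?thesis unfolding Lip_above_eq
    by (intro sets.countable_UN' sets.countable_INT') (blast | simp only: countableI_type)+
qed

lemma Lip_above_open_mono:
  "\<omega> \<in> Lip_above g \<Longrightarrow> (\<And>x. \<omega> x \<Longrightarrow> \<omega>' x) \<Longrightarrow> \<omega>' \<in> Lip_above g"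
  unfolding Lip_above_def by blast

section \<open>Zero-one law for Lipschitz surfaces\<close>

lemma measure_Lip_above_shift:
  "measure (site_perc p) (Lip_above (\<lambda>x. g x + m)) = measure (site_perc p) (Lip_above g)"
proof -
  define up :: "'a site \<Rightarrow> 'a site" where "up z = (fst z, snd z + m)" for z
  define T :: "'a config \<Rightarrow> 'a config" where "T \<omega> = (\<lambda>z. \<omega> (up z))" for \<omega>
  have "inj up" by (auto simp: inj_def up_def prod_eq_iff)
  then have distr: "distr (site_perc p) (site_perc p) T = site_perc p"
    using distr_PiM_reindex[of UNIV "\<lambda>_. measure_pmf (bernoulli_pmf p)" up UNIV]
    by (simp add: site_perc_def T_def[abs_def] restrict_def measure_pmf.prob_space_axioms)
  have T: "T \<in> measurable (site_perc p) (site_perc p)"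
    unfolding site_perc_def T_def by (rule measurable_PiM_single')
      (auto simp: space_PiM intro: measurable_compose[OF measurable_component_singleton])
  have "T -` Lip_above g = Lip_above (\<lambda>x. g x + m)"
  proof (intro set_eqI iffI)
    fix \<omega> assume "\<omega> \<in> T -` Lip_above g"
    then obtain F where "lipschitz_fun F" "\<And>x. \<omega> (x, F x + m)" "\<And>x. g x < F x"
      by (auto simp: Lip_above_def T_def up_def)
    then show "\<omega> \<in> Lip_above (\<lambda>x. g x + m)"
      unfolding Lip_above_def by (auto simp: lipschitz_fun_def intro!: exI[of _ "\<lambda>x. F x + m"])
  next
    fix \<omega> assume "\<omega> \<in> Lip_above (\<lambda>x. g x + m)"
    then obtain F where "lipschitz_fun F" "\<And>x. \<omega> (x, F x)" "\<And>x. g x + m < F x"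
      by (auto simp: Lip_above_def)
    then show "\<omega> \<in> T -` Lip_above g"
      unfolding Lip_above_def
      by (auto simp: lipschitz_fun_def T_def up_def less_diff_eq intro!: exI[of _ "\<lambda>x. F x - m"])
  qed
  then have "measure (site_perc p) (Lip_above (\<lambda>x. g x + m)) = measure (distr (site_perc p) (site_perc p) T) (Lip_above g)"
    using measure_distr[OF T sets_Lip_above, of g] by simp
  then show ?thesis by (simp add: distr)
qed

lemma ex_bij_nat_site: "\<exists>e :: nat \<Rightarrow> 'd::finite site. bij e"
proof -
  have "infinite (UNIV :: 'd site set)"
    by (simp add: finite_prod infinite_UNIV_int)
  then show ?thesis
    using bij_betw_from_nat_into[of "UNIV :: 'd site set"] by auto
qed

text \<open>Whether a surface above \<open>g\<close> exists may depend on the sites just above \<open>g\<close>, so the event is not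
itself a tail event. But it contains the event that there are surfaces above \<open>g + m\<close> for every
\<open>m\<close>, and by vertical translation invariance the two have the same probability. The smaller event is
invariant under finite modifications: take a surface that passes above all modified sites.\<close>

lemma Lip_above_zero_one:
  fixes g :: "int ^ 'd::finite \<Rightarrow> int"
  shows "measure (site_perc p) (Lip_above g) \<in> {0, 1}"
proof -
  interpret prob_space "site_perc p :: 'd config measure" by (rule prob_space_site_perc)
  define L where "L m = Lip_above (\<lambda>x. g x + int m)" for m
  have sets_L: "range L \<subseteq> events" by (auto simp: L_def sets_Lip_above)
  have dec: "decseq L"
    unfolding decseq_def L_def Lip_above_def
    by (intro allI impI subsetI CollectI, elim CollectE exE) (smt (verit) of_nat_mono)
  have "(\<lambda>m. prob (L m)) \<longlonglongrightarrow> prob (\<Inter>m. L m)"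
    by (rule finite_Lim_measure_decseq[OF sets_L dec])
  moreover have "prob (L m) = prob (Lip_above g)" for m
    unfolding L_def by (rule measure_Lip_above_shift)
  ultimately have eq: "prob (Lip_above g) = prob (\<Inter>m. L m)"
    using LIMSEQ_unique[OF tendsto_const] by simp
  obtain e :: "nat \<Rightarrow> 'd site" where e: "bij e" using ex_bij_nat_site by blast
  have "prob (\<Inter>m. L m) \<in> {0, 1}"
    unfolding site_perc_def
  proof (rule zero_one_finite_modification[OF e measure_pmf.prob_space_axioms])
    show "(\<Inter>m. L m) \<in> sets (\<Pi>\<^sub>M x\<in>UNIV. measure_pmf (bernoulli_pmf p))"
      using sets.countable_INT[OF sets_L] by (simp add: site_perc_def)
  next
    fix \<omega> \<omega>' :: "'d config"
    assume \<omega>: "\<omega> \<in> (\<Inter>m. L m)" and fin: "finite {z. \<omega> z \<noteq> \<omega>' z}"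
    \<comment> \<open>Modified sites lie at most \<open>K\<close> above the obstacle.\<close>
    define K where "K = Max (insert 0 ((\<lambda>z. nat (snd z - g (fst z))) ` {z. \<omega> z \<noteq> \<omega>' z}))"
    have K: "nat (snd z - g (fst z)) \<le> K" if "\<omega> z \<noteq> \<omega>' z" for z
      unfolding K_def using fin that by (intro Max_ge) auto
    show "\<omega>' \<in> (\<Inter>m. L m)"
    proof
      fix m
      have "\<omega> \<in> L (max m K)" using \<omega> by blast
      then obtain F where F: "lipschitz_fun F" "\<And>x. \<omega> (x, F x)" "\<And>x. g x + int (max m K) < F x"
        by (auto simp: L_def Lip_above_def)
      have "\<omega>' (x, F x)" for x
      proof (rule ccontr)
        assume "\<not> \<omega>' (x, F x)"
        then have "nat (F x - g x) \<le> K" using K[of "(x, F x)"] F(2)[of x] by simp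
        then show False using F(3)[of x] by linarith
      qed
      moreover have "g x + int m < F x" for x using F(3)[of x] by linarith
      ultimately show "\<omega>' \<in> L m" unfolding L_def Lip_above_def using F(1) by blast
    qed
  qed simp
  then show ?thesis using eq by simp
qed

section \<open>Small parameters\<close>

text \<open>Over a fixed sequence of base points there are \<open>3\<^sup>n\<close> Lipschitz paths of
\<open>n\<close> steps with a given initial height. Each of them visits \<open>n + 1\<close> different sites.\<close>

lemma open_path_cover:
  fixes x :: "nat \<Rightarrow> int ^ 'd::finite"
  assumes p: "0 \<le> p" "p \<le> 1" and x: "inj x"
  shows "\<exists>V\<in>sets (site_perc p).
    {\<omega>. \<exists>f. f 0 = h \<and> (\<forall>i<n. \<bar>f (Suc i) - f i\<bar> \<le> 1) \<and> (\<forall>i\<le>n. \<omega> (x i, f i))} \<subseteq> V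
      \<and> measure (site_perc p) V \<le> 3 ^ n * p ^ Suc n" (is "\<exists>V\<in>_. ?W \<subseteq> V \<and> _")
proof -
  interpret prob_space "site_perc p :: 'd config measure" by (rule prob_space_site_perc)
  define I where "I = PiE {..<n} (\<lambda>_. {-1, 0, 1 :: int})"
  define A where "A \<delta> = {\<omega>. \<forall>i\<in>{..n}. \<omega> (x i, h + (\<Sum>l<i. \<delta> l))}" for \<delta>
  have W: "?W \<subseteq> (\<Union>\<delta>\<in>I. A \<delta>)"
  proof
    fix \<omega> assume "\<omega> \<in> ?W"
    then obtain f where f: "f 0 = h" "\<And>i. i < n \<Longrightarrow> \<bar>f (Suc i) - f i\<bar> \<le> 1" "\<And>i. i \<le> n \<Longrightarrow> \<omega> (x i, f i)"
      by auto
    \<comment> \<open>A path is encoded by its initial height and its height differences.\<close>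
    define \<delta> where "\<delta> = (\<lambda>i\<in>{..<n}. f (Suc i) - f i)"
    have "f (Suc i) - f i \<in> {-1, 0, 1}" if "i < n" for i
      using f(2)[OF that] by auto
    then have "\<delta> \<in> I" by (simp add: \<delta>_def I_def)
    moreover have "f i = h + (\<Sum>l<i. \<delta> l)" if "i \<le> n" for i
    proof -
      have "(\<Sum>l<i. \<delta> l) = (\<Sum>l<i. f (Suc l) - f l)"
        using that by (intro sum.cong) (auto simp: \<delta>_def)
      then show ?thesis using f(1) by (simp add: sum_lessThan_telescope)
    qed
    then have "\<omega> \<in> A \<delta>" using f(3) by (auto simp: A_def)
    ultimately show "\<omega> \<in> (\<Union>\<delta>\<in>I. A \<delta>)" by blast
  qed
  have sets_A: "A \<delta> \<in> events" for \<delta>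
    using sets_all_sites[of "{..n}" "\<lambda>i. (x i, h + (\<Sum>l<i. \<delta> l))" True p] by (simp add: A_def)
  have "finite I" by (auto simp: I_def intro: finite_PiE)
  have "prob (\<Union>\<delta>\<in>I. A \<delta>) \<le> (\<Sum>\<delta>\<in>I. prob (A \<delta>))"
    using sets_A \<open>finite I\<close> by (intro finite_measure_subadditive_finite) auto
  also have "\<dots> = (\<Sum>\<delta>\<in>I. p ^ Suc n)"
  proof (rule sum.cong)
    fix \<delta>
    let ?s = "\<lambda>i. (x i, h + (\<Sum>l<i. \<delta> l))"
    have "inj_on ?s {..n}" using x by (auto simp: inj_on_def inj_def)
    then have "card (?s ` {..n}) = Suc n" by (simp add: card_image)
    moreover have "A \<delta> = {\<omega>. \<forall>z\<in>?s ` {..n}. \<omega> z = True}" by (simp add: A_def)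
    ultimately show "prob (A \<delta>) = p ^ Suc n"
      using prob_all_sites[of "?s ` {..n}" p True] p by simp
  qed simp
  also have "\<dots> = 3 ^ n * p ^ Suc n" by (simp add: I_def card_PiE)
  finally show ?thesis using W sets_A \<open>finite I\<close> by (intro bexI[of _ "\<Union>\<delta>\<in>I. A \<delta>"]) auto
qed

text \<open>An open surface restricted to a coordinate half-axis is an infinite open Lipschitz path. For fixed
initial height the expected number of such paths of length \<open>n\<close> vanishes as \<open>n\<close> grows.\<close>

lemma Lip_above_null:
  fixes g :: "int ^ 'd::finite \<Rightarrow> int"
  assumes p: "0 \<le> p" "p < 1 / 3"
  shows "measure (site_perc p) (Lip_above g) = 0"
proof -
  interpret prob_space "site_perc p :: 'd config measure" by (rule prob_space_site_perc)
  define x :: "nat \<Rightarrow> int ^ 'd" where "x i = axis undefined (int i)" for i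
  have x: "inj x" by (auto simp: inj_def x_def axis_eq_axis)
  have x_step: "l1norm (x (Suc i) - x i) = 1" for i
  proof -
    have "l1norm (x (Suc i) - x i) = (\<Sum>j\<in>(UNIV :: 'd set). if j = undefined then 1 else 0)"
      unfolding l1norm_def x_def by (intro sum.cong) (auto simp: axis_def)
    then show ?thesis by simp
  qed
  define W :: "int \<Rightarrow> nat \<Rightarrow> 'd config set" where "W h n = {\<omega>. \<exists>f. f 0 = h \<and> (\<forall>i<n. \<bar>f (Suc i) - f i\<bar> \<le> 1) \<and> (\<forall>i\<le>n. \<omega> (x i, f i))}" for h n
  have "\<exists>V. V \<in> events \<and> W h n \<subseteq> V \<and> prob V \<le> 3 ^ n * p ^ Suc n" for h n
    using open_path_cover[OF p(1) _ x, of h n] p unfolding W_def Bex_def by simp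
  then obtain V where "\<And>h n. V h n \<in> events \<and> W h n \<subseteq> V h n \<and> prob (V h n) \<le> 3 ^ n * p ^ Suc n"
    by metis
  then have V: "\<And>h n. V h n \<in> events" "\<And>h n. W h n \<subseteq> V h n" "\<And>h n. prob (V h n) \<le> 3 ^ n * p ^ Suc n"
    by blast+
  have sets_V: "(\<Inter>n. V h n) \<in> events" for h using V(1) by blast
  have "(\<Inter>n. V h n) \<in> null_sets (site_perc p)" for h
  proof -
    have "(\<lambda>n. p * (3 * p) ^ n) \<longlonglongrightarrow> p * 0"
      using p by (intro tendsto_mult tendsto_const LIMSEQ_power_zero) simp
    moreover have "prob (\<Inter>n. V h n) \<le> p * (3 * p) ^ n" for n
    proof -
      have "prob (\<Inter>n. V h n) \<le> prob (V h n)" using V(1) by (intro finite_measure_mono) auto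
      also have "\<dots> \<le> p * (3 * p) ^ n" using V(3)[of h n] by (simp add: power_mult_distrib mult_ac)
      finally show ?thesis .
    qed
    ultimately have "prob (\<Inter>n. V h n) \<le> p * 0" by (intro LIMSEQ_le_const) auto
    then have "prob (\<Inter>n. V h n) = 0" by (simp add: measure_le_0_iff)
    then show ?thesis using sets_V by (simp add: null_sets_def emeasure_eq_measure)
  qed
  then have null: "(\<Union>h. \<Inter>n. V h n) \<in> null_sets (site_perc p)" by (intro null_sets_UN') auto
  have "Lip_above g \<subseteq> (\<Union>h. \<Inter>n. V h n)"
  proof
    fix \<omega> assume "\<omega> \<in> Lip_above g"
    then obtain F where F: "lipschitz_fun F" "\<And>y. \<omega> (y, F y)" by (auto simp: Lip_above_def)
    have "\<omega> \<in> W (F (x 0)) n" for n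
      unfolding W_def using F x_step by (auto simp: lipschitz_fun_def intro!: exI[of _ "\<lambda>i. F (x i)"])
    then show "\<omega> \<in> (\<Union>h. \<Inter>n. V h n)" using V(2) by blast
  qed
  then have "Lip_above g \<in> null_sets (site_perc p)"
    by (rule null_sets_subset[OF null sets_Lip_above])
  then show ?thesis by (rule measure_eq_0_null_sets)
qed

section \<open>Countable unions and sums of product weights\<close>

lemma (in finite_measure) measure_countable_UN_le:
  assumes Y: "countable Y" and A: "\<And>s. s \<in> Y \<Longrightarrow> A s \<in> sets M"
    and le: "\<And>X. finite X \<Longrightarrow> X \<subseteq> Y \<Longrightarrow> (\<Sum>s\<in>X. measure M (A s)) \<le> c"
  shows "measure M (\<Union>s\<in>Y. A s) \<le> c"
proof (cases "Y = {}")
  case True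
  then show ?thesis using le[of "{}"] by simp
next
  case False
  define y where "y = from_nat_into Y"
  have y: "range y = Y" using Y False by (simp add: y_def)
  define B where "B N = (\<Union>s\<in>y ` {..N}. A s)" for N
  have sets_B: "B N \<in> sets M" for N unfolding B_def using A y by (intro sets.finite_UN) auto
  have "measure M (B N) \<le> c" for N
  proof -
    have "measure M (B N) \<le> (\<Sum>s\<in>y ` {..N}. measure M (A s))"
      unfolding B_def using A y by (intro finite_measure_subadditive_finite) auto
    also have "\<dots> \<le> c" using y by (intro le) auto
    finally show ?thesis .
  qed
  moreover have "(\<lambda>N. measure M (B N)) \<longlonglongrightarrow> measure M (\<Union>N. B N)"
    using sets_B by (intro finite_Lim_measure_incseq) (auto simp: incseq_def B_def intro!: bexI)
  ultimately have "measure M (\<Union>N. B N) \<le> c" by (intro LIMSEQ_le_const2) auto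
  moreover have "(\<Union>N. B N) = (\<Union>s\<in>Y. A s)" unfolding B_def y[symmetric] by auto
  ultimately show ?thesis by simp
qed

text \<open>The family \<open>X\<close> lies in the product of its finite coordinate projections, over which the sum factorises.\<close>

lemma sum_prod_extensional_le:
  fixes f :: "'i \<Rightarrow> 'b \<Rightarrow> real"
  assumes I: "finite I" and X: "finite X" "X \<subseteq> extensional I"
    and f: "\<And>i t. i \<in> I \<Longrightarrow> 0 \<le> f i t"
    and K: "\<And>i B. i \<in> I \<Longrightarrow> finite B \<Longrightarrow> (\<Sum>t\<in>B. f i t) \<le> K i"
  shows "(\<Sum>v\<in>X. \<Prod>i\<in>I. f i (v i)) \<le> (\<Prod>i\<in>I. K i)"
proof -
  define B where "B i = (\<lambda>v. v i) ` X" for i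
  have B: "finite (B i)" for i using X by (simp add: B_def)
  have "(\<Sum>v\<in>X. \<Prod>i\<in>I. f i (v i)) \<le> (\<Sum>v\<in>PiE I B. \<Prod>i\<in>I. f i (v i))"
  proof (rule sum_mono2)
    show "finite (PiE I B)" using I B by (intro finite_PiE) auto
    show "X \<subseteq> PiE I B" using X by (auto simp: PiE_def B_def)
  qed (auto intro: prod_nonneg f)
  also have "\<dots> = (\<Prod>i\<in>I. \<Sum>t\<in>B i. f i t)"
    using I B by (intro prod_sum_PiE[symmetric]) auto
  also have "\<dots> \<le> (\<Prod>i\<in>I. K i)"
    using B by (intro prod_mono) (auto intro: sum_nonneg f K)
  finally show ?thesis .
qed

lemma sum_prod_vec_le:
  fixes f :: "'d::finite \<Rightarrow> 'b \<Rightarrow> real"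
  assumes B: "finite B" and f: "\<And>j t. 0 \<le> f j t"
    and K: "\<And>j B. finite B \<Longrightarrow> (\<Sum>t\<in>B. f j t) \<le> K j"
  shows "(\<Sum>v\<in>B. \<Prod>j\<in>UNIV. f j (v $ j)) \<le> (\<Prod>j\<in>UNIV. K j)"
proof -
  have "(\<Sum>v\<in>B. \<Prod>j\<in>UNIV. f j (v $ j)) = (\<Sum>v\<in>vec_nth ` B. \<Prod>j\<in>UNIV. f j (v j))"
    by (subst sum.reindex) (auto simp: inj_on_def vec_nth_inject)
  also have "\<dots> \<le> (\<Prod>j\<in>UNIV. K j)"
    using assms by (intro sum_prod_extensional_le) auto
  finally show ?thesis .
qed

text \<open>The chord bound for a convex function between 0 and 1.\<close>

lemma two_powr_minus_le:
  assumes "0 \<le> t" "t \<le> 1"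
  shows "2 powr - t \<le> 1 - t / (2 :: real)"
proof -
  have "exp ((1 - t) *\<^sub>R 0 + t *\<^sub>R (- ln 2)) \<le> (1 - t) * exp 0 + t * exp (- ln (2 :: real))"
    using assms by (intro convex_onD[OF exp_convex]) auto
  then show ?thesis by (simp add: powr_def exp_minus)
qed

lemma sum_two_powr_le:
  assumes c: "0 < c" "c \<le> 1" and c': "c \<le> (c' :: real)"
  shows "(\<Sum>i\<le>N. 2 powr - (c' * real i)) \<le> 2 / c"
proof -
  define x where "x = 2 powr - c"
  have x: "0 < x" "x \<le> 1 - c / 2" using two_powr_minus_le[of c] c by (auto simp: x_def)
  then have "x < 1" using c by simp
  have "(\<Sum>i\<le>N. 2 powr - (c' * real i)) \<le> (\<Sum>i\<le>N. x ^ i)"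
  proof (rule sum_mono)
    fix i
    have "2 powr - (c' * real i) \<le> 2 powr (- c * real i)"
      using c' by (intro powr_mono) (auto intro: mult_right_mono)
    also have "\<dots> = x ^ i" by (simp add: x_def powr_realpow[symmetric] powr_powr)
    finally show "2 powr - (c' * real i) \<le> x ^ i" .
  qed
  also have "\<dots> \<le> (\<Sum>i. x ^ i)"
    using x \<open>x < 1\<close> by (intro sum_le_suminf summable_geometric) auto
  also have "\<dots> = 1 / (1 - x)" using x \<open>x < 1\<close> by (intro suminf_geometric) simp
  also have "\<dots> \<le> 1 / (c / 2)" using x c by (intro divide_left_mono) auto
  finally show ?thesis by simp
qed

text \<open>The sum splits into two geometric series with exponents \<open>1 + \<alpha> e\<close> and \<open>1 - \<alpha> e\<close> that share the term
of 0. An exponent of at least 1 gives at most 2. The only exponent that can be smaller is \<open>1 - \<alpha>\<close>; it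
arises once if \<open>e \<noteq> 0\<close> and contributes at most \<open>2 / (1 - \<alpha>)\<close>.\<close>

lemma sum_tilted_weight_le:
  assumes \<alpha>: "0 \<le> \<alpha>" "\<alpha> < (1 :: real)" and e: "e \<in> {-1, 0, 1 :: int}" and B: "finite B"
  shows "(\<Sum>t\<in>B. 2 powr - (\<bar>real_of_int t\<bar> + \<alpha> * of_int (e * t))) \<le> 3 / (if e = 0 then 1 else 1 - \<alpha>)"
proof -
  let ?f = "\<lambda>t :: int. 2 powr - (\<bar>real_of_int t\<bar> + \<alpha> * of_int (e * t))"
  define N where "N = nat (Max (insert 0 (abs ` B)))"
  have N: "\<bar>t\<bar> \<le> int N" if "t \<in> B" for t
  proof -
    have "\<bar>t\<bar> \<le> Max (insert 0 (abs ` B))" using B that by (intro Max_ge) auto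
    then show ?thesis unfolding N_def by linarith
  qed
  have "B \<subseteq> int ` {..N} \<union> (\<lambda>i. - int i) ` {1..N}"
  proof
    fix t assume "t \<in> B"
    then have *: "\<bar>t\<bar> \<le> int N" by (rule N)
    show "t \<in> int ` {..N} \<union> (\<lambda>i. - int i) ` {1..N}"
    proof (cases "t \<ge> 0")
      case True
      with * have "t = int (nat t)" "nat t \<le> N" by auto
      then show ?thesis by blast
    next
      case False
      with * have "t = - int (nat (- t))" "nat (- t) \<in> {1..N}" by auto
      then show ?thesis by blast
    qed
  qed
  then have "(\<Sum>t\<in>B. ?f t) \<le> (\<Sum>t\<in>int ` {..N} \<union> (\<lambda>i. - int i) ` {1..N}. ?f t)"
    by (intro sum_mono2) auto
  also have "\<dots> = (\<Sum>t\<in>int ` {..N}. ?f t) + (\<Sum>t\<in>(\<lambda>i. - int i) ` {1..N}. ?f t)"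
    by (intro sum.union_disjoint) auto
  also have "(\<Sum>t\<in>int ` {..N}. ?f t) = (\<Sum>i\<le>N. 2 powr - ((1 + \<alpha> * e) * real i))"
    by (subst sum.reindex) (auto simp: algebra_simps)
  also have "(\<Sum>t\<in>(\<lambda>i. - int i) ` {1..N}. ?f t) = (\<Sum>i=1..N. 2 powr - ((1 - \<alpha> * e) * real i))"
    by (subst sum.reindex) (auto simp: inj_on_def algebra_simps)
  also have "\<dots> = (\<Sum>i\<le>N. 2 powr - ((1 - \<alpha> * e) * real i)) - 1"
    by (simp add: atMost_atLeast0 sum.atLeast_Suc_atMost)
  finally have split: "(\<Sum>t\<in>B. ?f t) \<le> (\<Sum>i\<le>N. 2 powr - ((1 + \<alpha> * e) * real i))
      + (\<Sum>i\<le>N. 2 powr - ((1 - \<alpha> * e) * real i)) - 1" by simp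
  have small: "(\<Sum>i\<le>N. 2 powr - (c * real i)) \<le> 2" if "1 \<le> c" for c
    using sum_two_powr_le[of 1 c N] that by simp
  have large: "(\<Sum>i\<le>N. 2 powr - ((1 - \<alpha>) * real i)) \<le> 2 / (1 - \<alpha>)"
    using \<alpha> by (intro sum_two_powr_le) auto
  have "1 \<le> 1 / (1 - \<alpha>)" using \<alpha> by simp
  moreover have "2 / (1 - \<alpha>) + 1 / (1 - \<alpha>) = 3 / (1 - \<alpha>)"
    by (simp add: add_divide_distrib[symmetric])
  ultimately have one: "2 / (1 - \<alpha>) + 1 \<le> 3 / (1 - \<alpha>)" by linarith
  consider "e = 0" | "e = 1" | "e = -1" using e by auto
  then show ?thesis
  proof cases
    case 1
    then show ?thesis using split small[of 1] by simp
  next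
    case 2
    then show ?thesis using split small[of "1 + \<alpha>"] large one \<alpha> by simp
  next
    case 3
    then show ?thesis using split small[of "1 + \<alpha>"] large one \<alpha> by simp
  qed
qed

section \<open>First moment of climbing chains\<close>

text \<open>The last increment leads from the endpoint to the origin. With it the increments determine the
chain: the base points by summation from the end, and then the heights from \<open>g\<close> at the start.\<close>

definition increments :: "nat \<Rightarrow> (nat \<Rightarrow> 'd::finite site) \<Rightarrow> nat \<Rightarrow> int ^ 'd" where
  "increments n s = (\<lambda>i\<in>{..n}. (if i < n then fst (s (Suc i)) else 0) - fst (s i))"

lemma sum_increments:
  assumes "i \<le> n"
  shows "(\<Sum>l=i..n. increments n s l) = - fst (s i)"
  using assms
proof (induction rule: inc_induct)
  case base
  then show ?case by (simp add: increments_def)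
next
  case (step i)
  then show ?case by (simp add: sum.atLeast_Suc_atMost increments_def)
qed

lemma jump_chain_height:
  assumes "jump_chain g n s" "i \<le> n"
  shows "snd (s i) = g (fst (s 0)) + int i - (\<Sum>l<i. l1norm (increments n s l))"
  using assms(2)
proof (induction i)
  case 0
  then show ?case using assms by (simp add: jump_chain_def)
next
  case (Suc i)
  then show ?case using assms by (simp add: jump_chain_def increments_def)
qed

lemma inj_on_increments:
  "inj_on (increments n) (chain_shapes g m n)"
proof (rule inj_onI)
  fix s t assume s: "s \<in> chain_shapes g m n" and t: "t \<in> chain_shapes g m n"
    and eq: "increments n s = increments n t"
  have fst: "fst (s i) = fst (t i)" if "i \<le> n" for i
    using sum_increments[OF that, of s] sum_increments[OF that, of t] eq by simp
  have "snd (s i) = snd (t i)" if "i \<le> n" for i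
    using jump_chain_height[of g n s i] jump_chain_height[of g n t i] s t that eq fst[of 0]
    by (simp add: chain_shapes_def)
  with fst show "s = t"
    using s t by (intro extensionalityI[of s "{..n}" t]) (auto simp: chain_shapes_def prod_eq_iff)
qed

lemma jump_chain_cone_height:
  assumes "jump_chain g n s"
  shows "cone_height (s n) = g (fst (s 0)) + int n - (\<Sum>l\<le>n. l1norm (increments n s l))"
proof -
  have "(\<Sum>l\<le>n. l1norm (increments n s l)) = (\<Sum>l<n. l1norm (increments n s l)) + l1norm (fst (s n))"
    by (simp add: lessThan_Suc_atMost[symmetric] increments_def)
  then show ?thesis using jump_chain_height[OF assms, of n] by (simp add: cone_height_def)
qed

text \<open>In a chain of minimal length that climbs to height \<open>m\<close>, no site occurs twice: the loop between two occurrences could be cut out.\<close>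

lemma climbs_inj:
  assumes "\<omega> \<in> climbs g m n"
  shows "\<exists>n. \<exists>s\<in>chain_shapes g m n. inj_on s {..n} \<and> (\<forall>i\<in>{1..n}. \<not> \<omega> (s i))"
proof -
  define n' where "n' = (LEAST n. \<omega> \<in> climbs g m n)"
  have n': "\<omega> \<in> climbs g m n'" unfolding n'_def using assms by (rule LeastI)
  have least: "n' \<le> l" if "\<omega> \<in> climbs g m l" for l unfolding n'_def using that by (rule Least_le)
  obtain s where s: "s \<in> chain_shapes g m n'" "\<forall>i\<in>{1..n'}. \<not> \<omega> (s i)"
    using n' by (auto simp: climbs_eq)
  have "inj_on s {..n'}"
  proof (rule linorder_inj_onI, goal_cases)
    case (1 i j)
    show ?case
    proof
      assume ij: "s i = s j"
      define d where "d = j - i"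
      \<comment> \<open>The chain without the loop from index \<open>i\<close> to index \<open>j\<close>.\<close>
      define s' where "s' l = (if l \<le> i then s l else s (l + d))" for l
      have s'_end: "s' (n' - d) = s n'"
      proof (cases "n' - d \<le> i")
        case True
        then have "j = n'" "n' - d = i" using 1 by (auto simp: d_def)
        then show ?thesis using ij by (simp add: s'_def)
      next
        case False
        then show ?thesis using 1 by (simp add: s'_def d_def)
      qed
      have "jump_chain g n' s" "m \<le> cone_height (s n')" using s by (auto simp: chain_shapes_def)
      have "closed_chain g \<omega> (n' - d) s'"
        unfolding closed_chain_def jump_chain_def
      proof (intro conjI allI impI ballI)
        show "snd (s' 0) = g (fst (s' 0))"
          using \<open>jump_chain g n' s\<close> by (simp add: s'_def jump_chain_def)
      next
        fix l assume l: "l < n' - d"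
        have step: "snd (s (Suc l)) = snd (s l) + 1 - l1norm (fst (s (Suc l)) - fst (s l))" if "l < n'" for l
          using \<open>jump_chain g n' s\<close> that by (simp add: jump_chain_def)
        show "snd (s' (Suc l)) = snd (s' l) + 1 - l1norm (fst (s' (Suc l)) - fst (s' l))"
        proof (cases "l = i")
          case True
          then have "s' l = s (l + d)" "s' (Suc l) = s (Suc (l + d))"
            using ij 1 by (auto simp: s'_def d_def)
          then show ?thesis using step[of "l + d"] l by simp
        next
          case False
          then show ?thesis using step[of l] step[of "l + d"] l by (auto simp: s'_def)
        qed
      next
        fix l assume "l \<in> {1..n' - d}"
        then show "\<not> \<omega> (s' l)" using s(2) by (auto simp: s'_def)
      qed
      then have "\<omega> \<in> climbs g m (n' - d)"
        using s'_end \<open>m \<le> cone_height (s n')\<close> by (auto simp: climbs_def)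
      from least[OF this] show False using 1 by (simp add: d_def)
    qed
  qed auto
  then show ?thesis using s by blast
qed

text \<open>Since the increments determine the chain, the product weights of any finite set of chains sum to at
most \<open>K\<^bsup>n+1\<^esup>\<close>. Since no site is repeated, each chain is closed with probability \<open>(1 - p)\<^sup>n\<close>.\<close>

lemma prob_inj_climb_le:
  fixes g :: "int ^ 'd::finite \<Rightarrow> int" and f :: "int ^ 'd \<Rightarrow> real"
  assumes p: "0 \<le> p" "p \<le> 1"
    and f: "\<And>v. 0 \<le> f v" and K: "\<And>B. finite B \<Longrightarrow> (\<Sum>v\<in>B. f v) \<le> K"
    and gf: "\<And>s. s \<in> chain_shapes g m n \<Longrightarrow> 1 \<le> c * (\<Prod>i\<le>n. f (increments n s i))"
    and c: "0 \<le> c"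
  shows "measure (site_perc p) (\<Union>s\<in>{s \<in> chain_shapes g m n. inj_on s {..n}}. {\<omega>. \<forall>i\<in>{1..n}. \<not> \<omega> (s i)})
    \<le> (1 - p) ^ n * (c * K ^ Suc n)"
proof -
  interpret prob_space "site_perc p :: 'd config measure" by (rule prob_space_site_perc)
  show ?thesis
  proof (rule measure_countable_UN_le)
    show "countable {s \<in> chain_shapes g m n. inj_on s {..n}}"
      by (rule countable_subset[OF _ countable_chain_shapes[of g m n]]) auto
  next
    fix s show "{\<omega>. \<forall>i\<in>{1..n}. \<not> \<omega> (s i)} \<in> events"
      using sets_all_sites[of "{1..n}" s False p] by simp
  next
    fix X :: "(nat \<Rightarrow> 'd site) set" assume X: "finite X" "X \<subseteq> {s \<in> chain_shapes g m n. inj_on s {..n}}"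
    have prob: "prob {\<omega>. \<forall>i\<in>{1..n}. \<not> \<omega> (s i)} = (1 - p) ^ n" if "s \<in> X" for s
    proof -
      have "inj_on s {1..n}" using that X by (auto intro: inj_on_subset)
      then have "card (s ` {1..n}) = n" by (simp add: card_image)
      moreover have "{\<omega>. \<forall>i\<in>{1..n}. \<not> \<omega> (s i)} = {\<omega>. \<forall>z\<in>s ` {1..n}. \<omega> z = False}" by auto
      ultimately show ?thesis using prob_all_sites[of "s ` {1..n}" p False] p by simp
    qed
    have inj: "inj_on (increments n) X"
      using X by (intro inj_on_subset[OF inj_on_increments[of n g m]]) auto
    have "(\<Sum>s\<in>X. \<Prod>i\<le>n. f (increments n s i)) = (\<Sum>v\<in>increments n ` X. \<Prod>i\<le>n. f (v i))"
      by (simp add: sum.reindex[OF inj])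
    also have "\<dots> \<le> (\<Prod>i\<le>n. K)"
      using X f K by (intro sum_prod_extensional_le) (auto simp: increments_def)
    finally have count: "(\<Sum>s\<in>X. \<Prod>i\<le>n. f (increments n s i)) \<le> K ^ Suc n" by simp
    have "(\<Sum>s\<in>X. prob {\<omega>. \<forall>i\<in>{1..n}. \<not> \<omega> (s i)}) = (\<Sum>s\<in>X. (1 - p) ^ n * 1)"
      using prob by simp
    also have "\<dots> \<le> (\<Sum>s\<in>X. (1 - p) ^ n * (c * (\<Prod>i\<le>n. f (increments n s i))))"
      using X p gf by (intro sum_mono mult_left_mono) auto
    also have "\<dots> = (1 - p) ^ n * (c * (\<Sum>s\<in>X. \<Prod>i\<le>n. f (increments n s i)))"
      by (simp add: sum_distrib_left)
    also have "\<dots> \<le> (1 - p) ^ n * (c * K ^ Suc n)"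
      using count c p by (intro mult_left_mono) auto
    finally show "(\<Sum>s\<in>X. prob {\<omega>. \<forall>i\<in>{1..n}. \<not> \<omega> (s i)}) \<le> (1 - p) ^ n * (c * K ^ Suc n)" .
  qed
qed

text \<open>The event that no surface exists forces, for every \<open>m\<close>, a chain that climbs to height \<open>m\<close>. The
first moment bounds are summed over the lengths of the chains and vanish as \<open>m\<close> tends to infinity.\<close>

lemma Lip_above_almost_sure:
  fixes g :: "int ^ 'd::finite \<Rightarrow> int" and f :: "int ^ 'd \<Rightarrow> real"
  assumes p: "0 \<le> p" "p \<le> 1"
    and f: "\<And>v. 0 \<le> f v" and K: "\<And>B. finite B \<Longrightarrow> (\<Sum>v\<in>B. f v) \<le> K"
    and gf: "\<And>m n s. s \<in> chain_shapes g (int m) n \<Longrightarrow> 1 \<le> (1 / 2) ^ m * 2 ^ n * (\<Prod>i\<le>n. f (increments n s i))"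
    and small: "2 * (1 - p) * K < 1"
  shows "measure (site_perc p) (Lip_above g) = 1"
proof -
  interpret prob_space "site_perc p :: 'd config measure" by (rule prob_space_site_perc)
  define D where "D m n = (\<Union>s\<in>{s \<in> chain_shapes g (int m) n. inj_on s {..n}}. {\<omega>. \<forall>i\<in>{1..n}. \<not> \<omega> (s i)})" for m n
  have sets_D: "D m n \<in> events" for m n
  proof -
    have "countable {s \<in> chain_shapes g (int m) n. inj_on s {..n}}"
      by (rule countable_subset[OF _ countable_chain_shapes[of g "int m" n]]) auto
    then show ?thesis unfolding D_def
      using sets_all_sites[of "{1..n}" _ False p] by (intro sets.countable_UN') auto
  qed
  have "0 \<le> K" using K[of "{}"] by simp
  define r where "r = 2 * (1 - p) * K"
  have r: "0 \<le> r" "r < 1" using small p \<open>0 \<le> K\<close> by (auto simp: r_def)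
  have D: "prob (D m n) \<le> (1 / 2) ^ m * K * r ^ n" for m n
  proof -
    have "prob (D m n) \<le> (1 - p) ^ n * ((1 / 2) ^ m * 2 ^ n * K ^ Suc n)"
      unfolding D_def by (intro prob_inj_climb_le[where f = f]) (use p f K gf in auto)
    moreover have "r ^ n = 2 ^ n * (1 - p) ^ n * K ^ n"
      unfolding r_def by (simp only: power_mult_distrib)
    ultimately show ?thesis by (simp add: mult_ac)
  qed
  have "(UNIV - Lip_above g) \<subseteq> (\<Union>n. D m n)" for m
  proof
    fix \<omega> assume "\<omega> \<in> UNIV - Lip_above g"
    then obtain n where "\<omega> \<in> climbs g (int m) n" by (auto simp: Lip_above_iff)
    from climbs_inj[OF this] show "\<omega> \<in> (\<Union>n. D m n)" by (auto simp: D_def)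
  qed
  then have le: "prob (UNIV - Lip_above g) \<le> (1 / 2) ^ m * (K / (1 - r))" for m
  proof -
    have geo: "summable (\<lambda>n. (1 / 2) ^ m * K * r ^ n)"
      using r by (intro summable_mult summable_geometric) simp
    have sm: "summable (\<lambda>n. prob (D m n))"
      using D by (intro summable_comparison_test'[OF geo]) (simp add: measure_nonneg)
    have "prob (UNIV - Lip_above g) \<le> prob (\<Union>n. D m n)"
      using \<open>UNIV - Lip_above g \<subseteq> (\<Union>n. D m n)\<close> sets_D by (intro finite_measure_mono) auto
    also have "\<dots> \<le> (\<Sum>n. prob (D m n))"
      using sets_D sm by (intro finite_measure_subadditive_countably) auto
    also have "\<dots> \<le> (\<Sum>n. (1 / 2) ^ m * K * r ^ n)" by (intro suminf_le D sm geo)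
    also have "\<dots> = (1 / 2) ^ m * K * (1 / (1 - r))"
      using r by (subst suminf_mult) (auto simp: suminf_geometric intro: summable_geometric)
    finally show ?thesis by simp
  qed
  have "(\<lambda>m. (1 / 2) ^ m * (K / (1 - r))) \<longlonglongrightarrow> 0 * (K / (1 - r))"
    by (intro tendsto_mult tendsto_const LIMSEQ_power_zero) simp
  then have "prob (UNIV - Lip_above g) \<le> 0 * (K / (1 - r))"
    by (rule LIMSEQ_le_const) (use le in auto)
  then have "prob (UNIV - Lip_above g) = 0" by (simp add: measure_le_0_iff)
  then show ?thesis using prob_compl[OF sets_Lip_above, of g] by simp
qed

lemma LIP_eq_Lip_above:
  "LIP \<alpha> \<eta> = Lip_above (\<lambda>x. \<lfloor>\<alpha> * of_int (\<Sum>i\<in>UNIV. \<eta> $ i * x $ i)\<rfloor>)"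
  by (simp add: LIP_def Lip_above_def)

text \<open>A chain starts at the base point minus the sum of its increments. The height of the tilted plane
there is distributed over the increments, and turns the loss \<open>\<bar>v\<bar>\<close> of each of them into its cost.\<close>

lemma LIP_almost_sure:
  fixes \<eta> :: "int ^ 'd::finite"
  assumes p: "0 \<le> p" "p \<le> 1" and \<alpha>: "0 \<le> \<alpha>" "\<alpha> < 1"
    and \<eta>: "\<eta> \<in> sign_vectors" "l1norm \<eta> = int k"
    and small: "2 * (1 - p) * 3 ^ CARD('d) < (1 - \<alpha>) ^ k"
  shows "measure (site_perc p) (LIP \<alpha> \<eta>) = 1"
proof -
  define g where "g x = \<lfloor>\<alpha> * of_int (\<Sum>i\<in>UNIV. \<eta> $ i * x $ i)\<rfloor>" for x :: "int ^ 'd"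
  define cost where "cost v = (\<Sum>j\<in>UNIV. \<bar>real_of_int (v $ j)\<bar> + \<alpha> * of_int (\<eta> $ j * v $ j))" for v :: "int ^ 'd"
  define K where "K = (\<Prod>j\<in>UNIV. 3 / (if \<eta> $ j = 0 then 1 else 1 - \<alpha>))"
  have \<eta>': "\<eta> $ j \<in> {-1, 0, 1}" for j using \<eta> by (simp add: sign_vectors_def)
  have "K = 3 ^ CARD('d) / (1 - \<alpha>) ^ k"
  proof -
    have "int k = (\<Sum>j\<in>UNIV. if \<eta> $ j = 0 then 0 else 1)"
      unfolding \<eta>(2)[symmetric] l1norm_def
    proof (rule sum.cong)
      fix j show "\<bar>\<eta> $ j\<bar> = (if \<eta> $ j = 0 then 0 else 1)" using \<eta>'[of j] by auto
    qed simp
    also have "\<dots> = int (card {j. \<eta> $ j \<noteq> 0})"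
      by (simp add: sum.If_cases Compl_eq)
    finally have "k = card {j. \<eta> $ j \<noteq> 0}" by simp
    then have "(\<Prod>j\<in>UNIV. if \<eta> $ j = 0 then 1 else 1 - \<alpha>) = (1 - \<alpha>) ^ k"
      by (simp add: prod.If_cases Compl_eq)
    then show ?thesis by (simp add: K_def prod_dividef)
  qed
  then have small': "2 * (1 - p) * K < 1"
    using small \<alpha> by (simp add: divide_less_eq)
  have f: "2 powr - cost v = (\<Prod>j\<in>UNIV. 2 powr - (\<bar>real_of_int (v $ j)\<bar> + \<alpha> * of_int (\<eta> $ j * v $ j)))" for v
    unfolding cost_def sum_negf[symmetric] by (subst powr_sum) auto
  have "measure (site_perc p) (Lip_above g) = 1"
  proof (rule Lip_above_almost_sure[where f = "\<lambda>v. 2 powr - cost v", OF p _ _ _ small'])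
    fix B :: "(int ^ 'd) set" assume "finite B"
    then show "(\<Sum>v\<in>B. 2 powr - cost v) \<le> K"
      unfolding f K_def using sum_tilted_weight_le[OF \<alpha> \<eta>']
      by (intro sum_prod_vec_le[where f = "\<lambda>j t. 2 powr - (\<bar>real_of_int t\<bar> + \<alpha> * of_int (\<eta> $ j * t))"]) auto
  next
    fix m n s assume s: "s \<in> chain_shapes g (int m) n"
    let ?v = "increments n s"
    have chain: "jump_chain g n s" and m: "int m \<le> cone_height (s n)"
      using s by (auto simp: chain_shapes_def)
    have x0: "fst (s 0) = - (\<Sum>l\<le>n. ?v l)"
      using sum_increments[of 0 n s] by (simp add: atMost_atLeast0)
    have "real_of_int (g (fst (s 0))) \<le> \<alpha> * of_int (\<Sum>j\<in>UNIV. \<eta> $ j * fst (s 0) $ j)"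
      unfolding g_def by simp
    also have "(\<Sum>j\<in>UNIV. \<eta> $ j * fst (s 0) $ j) = - (\<Sum>l\<le>n. \<Sum>j\<in>UNIV. \<eta> $ j * ?v l $ j)"
      unfolding x0 by (subst sum.swap) (simp add: sum_distrib_left sum_negf)
    finally have "real_of_int (g (fst (s 0))) \<le> - (\<alpha> * (\<Sum>l\<le>n. \<Sum>j\<in>UNIV. real_of_int (\<eta> $ j * ?v l $ j)))"
      by simp
    moreover have "int m \<le> g (fst (s 0)) + int n - (\<Sum>l\<le>n. l1norm (?v l))"
      using m jump_chain_cone_height[OF chain] by simp
    then have "real m \<le> of_int (g (fst (s 0)) + int n - (\<Sum>l\<le>n. l1norm (?v l)))" by linarith
    then have "real m \<le> of_int (g (fst (s 0))) + real n - (\<Sum>l\<le>n. real_of_int (l1norm (?v l)))" by simp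
    moreover have "(\<Sum>l\<le>n. cost (?v l)) = (\<Sum>l\<le>n. real_of_int (l1norm (?v l)))
        + \<alpha> * (\<Sum>l\<le>n. \<Sum>j\<in>UNIV. real_of_int (\<eta> $ j * ?v l $ j))"
      by (simp add: cost_def l1norm_def sum.distrib sum_distrib_left)
    ultimately have "0 \<le> - real m + real n - (\<Sum>l\<le>n. cost (?v l))" by linarith
    then have "0 \<le> - real m + real n + (\<Sum>l\<le>n. - cost (?v l))"
      by (simp add: sum_negf)
    then have "2 powr 0 \<le> 2 powr (- real m + real n + (\<Sum>l\<le>n. - cost (?v l)))"
      by (intro powr_mono) auto
    also have "\<dots> = (1 / 2) ^ m * 2 ^ n * (\<Prod>l\<le>n. 2 powr - cost (?v l))"
    proof -
      have "2 powr - real m = (1 / 2) ^ m" "2 powr real n = (2 ^ n :: real)"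
        by (simp_all add: powr_minus powr_realpow power_one_over inverse_eq_divide)
      then show ?thesis by (simp only: powr_add powr_sum[OF zero_neq_numeral[symmetric]] finite_atMost)
    qed
    finally show "1 \<le> (1 / 2) ^ m * 2 ^ n * (\<Prod>l\<le>n. 2 powr - cost (?v l))" by simp
  qed simp
  then show ?thesis by (simp add: LIP_eq_Lip_above g_def[abs_def])
qed

section \<open>The critical parameter\<close>

text \<open>The threshold is the supremum of the parameters of probability zero. It is positive because
almost surely no surface exists for parameters below \<open>1/3\<close>, and at most \<open>c\<close> by assumption.\<close>

lemma p_L_le:
  fixes \<eta> :: "int ^ 'd::finite"
  assumes c: "c < 1"
    and one: "\<And>p. c < p \<Longrightarrow> 0 \<le> p \<Longrightarrow> p \<le> 1 \<Longrightarrow> measure (site_perc p) (LIP \<alpha> \<eta>) = 1"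
  shows "p_L \<alpha> \<eta> \<le> c"
proof -
  define P where "P p = measure (site_perc p) (LIP \<alpha> \<eta>)" for p
  have P01: "P p \<in> {0, 1}" for p
    unfolding P_def LIP_eq_Lip_above by (rule Lip_above_zero_one)
  have mono: "P p \<le> P p'" if "0 \<le> p" "p \<le> p'" "p' \<le> 1" for p p'
    unfolding P_def LIP_eq_Lip_above
    by (rule site_perc_mono[OF that sets_Lip_above]) (rule Lip_above_open_mono)
  have null: "P p = 0" if "0 \<le> p" "p < 1 / 3" for p
    unfolding P_def LIP_eq_Lip_above using that by (rule Lip_above_null)
  define Z where "Z = {p \<in> {0..1}. P p = 0}"
  define p\<^sub>c where "p\<^sub>c = Sup Z"
  have bdd: "bdd_above Z" by (auto simp: Z_def intro: bdd_aboveI[of _ 1])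
  have Z_le: "p \<le> c" if "p \<in> Z" for p
    using one[of p] that unfolding Z_def P_def by force
  have "1 / 4 \<in> Z" using null[of "1 / 4"] by (simp add: Z_def)
  then have "Z \<noteq> {}" by blast
  have pos: "0 < p\<^sub>c" using cSup_upper[OF \<open>1 / 4 \<in> Z\<close> bdd] by (simp add: p\<^sub>c_def)
  have le_c: "p\<^sub>c \<le> c" unfolding p\<^sub>c_def using \<open>1 / 4 \<in> Z\<close> Z_le by (intro cSup_least) auto
  have below: "P p = 0" if p: "p \<in> {0..1}" "p < p\<^sub>c" for p
  proof -
    obtain p' where "p' \<in> Z" "p < p'"
      using p less_cSup_iff[OF \<open>Z \<noteq> {}\<close> bdd, of p] by (auto simp: p\<^sub>c_def)
    then have "P p \<le> 0" using mono[of p p'] p by (simp add: Z_def)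
    then show ?thesis using P01[of p] by auto
  qed
  have above: "P p = 1" if "p \<in> {0..1}" "p\<^sub>c < p" for p
  proof -
    have "p \<notin> Z" using cSup_upper[OF _ bdd, of p] that by (auto simp: p\<^sub>c_def)
    then show ?thesis using P01[of p] that by (auto simp: Z_def)
  qed
  have "p_L \<alpha> \<eta> = p\<^sub>c"
    unfolding p_L_def P_def[symmetric]
  proof (rule the_equality)
    show "0 < p\<^sub>c \<and> p\<^sub>c < 1 \<and> (\<forall>p\<in>{0..1}. (p < p\<^sub>c \<longrightarrow> P p = 0) \<and> (p > p\<^sub>c \<longrightarrow> P p = 1))"
      using pos le_c c below above by auto
  next
    fix b assume b: "0 < b \<and> b < 1 \<and> (\<forall>p\<in>{0..1}. (p < b \<longrightarrow> P p = 0) \<and> (p > b \<longrightarrow> P p = 1))"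
    show "b = p\<^sub>c"
    proof (rule ccontr)
      assume "b \<noteq> p\<^sub>c"
      then have mid: "(b + p\<^sub>c) / 2 \<in> {0..1}" using b pos le_c c by auto
      consider "b < p\<^sub>c" | "p\<^sub>c < b" using \<open>b \<noteq> p\<^sub>c\<close> by linarith
      then show False
      proof cases
        case 1
        then show False using b mid below[OF mid] by force
      next
        case 2
        then show False using b mid above[OF mid] by force
      qed
    qed
  qed
  then show ?thesis using le_c by simp
qed

theorem proposition3p4:
  fixes k :: nat
  assumes "1 \<le> k" and "k \<le> CARD('d::finite)"
  shows "\<exists>C::real. C > 0 \<and>
           (\<forall>\<alpha>\<in>{0..<1}. \<forall>\<eta>::int ^ 'd. \<eta> \<in> sign_vectors \<and> l1norm \<eta> = int k \<longrightarrow>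
              q_L \<alpha> \<eta> \<ge> C * (1 - \<alpha>) ^ k)"
proof (intro exI conjI ballI allI impI)
  let ?C = "1 / (2 * 3 ^ CARD('d)) :: real"
  show "0 < ?C" by simp
  fix \<alpha> :: real and \<eta> :: "int ^ 'd"
  assume \<alpha>: "\<alpha> \<in> {0..<1}" and \<eta>: "\<eta> \<in> sign_vectors \<and> l1norm \<eta> = int k"
  have "p_L \<alpha> \<eta> \<le> 1 - ?C * (1 - \<alpha>) ^ k"
  proof (rule p_L_le)
    show "1 - ?C * (1 - \<alpha>) ^ k < 1" using \<alpha> by simp
    fix p assume p: "1 - ?C * (1 - \<alpha>) ^ k < p" "0 \<le> p" "p \<le> 1"
    then have "2 * (1 - p) * 3 ^ CARD('d) < (1 - \<alpha>) ^ k" by (simp add: field_simps)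
    then show "measure (site_perc p) (LIP \<alpha> \<eta>) = 1"
      using p \<alpha> \<eta> by (intro LIP_almost_sure) auto
  qed
  then show "q_L \<alpha> \<eta> \<ge> ?C * (1 - \<alpha>) ^ k" by (simp add: q_L_def)
qed

end
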